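(* Let $Y$ be a centered Gaussian process on $D\subset\mathbb{R}^d$ with covariance function $k$, let $h_1,\dots,h_m:D\to\mathbb{R}$ be known functions, $\beta=(\beta_1,\dots,\beta_m)^t\in\mathbb{R}^m$ an unknown vector, and $Z(x)=\sum_{i=1}^m\beta_ih_i(x)+Y(x)$ for $x\in D$. Let $X_1,\dots,X_p$ be a partition of the matrix $X$ of observation points $x_1,\dots,x_n\in D$. Let $x\in D$, $h(x)=(h_1(x),\dots,h_m(x))^t$, and let $M_{UK}(x)=(M_{UK,1}(x),\dots,M_{UK,p}(x))^t$ be the vector of universal Kriging sub-models (see context). For $i=1,\dots,p$ let $$w_i(x)^t=h(x)^t(H_i^tk(X_i,X_i)^{-1}H_i)^{-1}H_i^tk(X_i,X_i)^{-1}-k(x,X_i)k(X_i,X_i)^{-1}H_i(H_i^tk(X_i,X_i)^{-1}H_i)^{-1}H_i^tk(X_i,X_i)^{-1}+k(x,X_i)k(X_i,X_i)^{-1}.$$ Let $K_{UK,M}(x)$ be the $p\times p$ matrix with entries $(K_{UK,M}(x))_{i,j}=w_i(x)^tk(X_i,X_j)w_j(x)$, and $k_{UK,M}(x)$ the $p\times1$ vector with entries $(k_{UK,M}(x))_i=w_i(x)^tk(X_i,x)$. Let $1_p$ be the $p\times1$ vector with entries equal to one and $$\hat m_{UK,M}(x)=(1_p^tK_{UK,M}(x)^{-1}1_p)^{-1}1_p^tK_{UK,M}(x)^{-1}M_{UK}(x),$$ $$M_{\mathcal{A},UK}(x)=\hat m_{UK,M}(x)+k_{UK,M}(x)^tK_{UK,M}(x)^{-1}\big(M_{UK}(x)-\hat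 m_{UK,M}(x)1_p\big).$$ Then $M_{\mathcal{A},UK}(x)$ is a linear function of $M_{UK,1}(x),\dots,M_{UK,p}(x)$, satisfies $\mathrm{E}[M_{\mathcal{A},UK}(x)]=\mathrm{E}[Z(x)]$ for all possible values of $\beta$ in $\mathbb{R}^m$, and has smallest mean square prediction error (for predicting $Z(x)$) among all the predictors with these two properties. The vector of aggregation weights is $$\alpha_{\mathcal{A},UK}(x)^t=(1_p^tK_{UK,M}(x)^{-1}1_p)^{-1}1_p^tK_{UK,M}(x)^{-1}-k_{UK,M}(x)^tK_{UK,M}(x)^{-1}1_p(1_p^tK_{UK,M}(x)^{-1}1_p)^{-1}1_p^tK_{UK,M}(x)^{-1}+k_{UK,M}(x)^tK_{UK,M}(x)^{-1},$$ that is, $M_{\mathcal{A},UK}(x)=\alpha_{\mathcal{A},UK}(x)^tM_{UK}(x)$, and the mean square error is given by $$v_{\mathcal{A},UK}(x)=\mathrm{E}\big[(M_{\mathcal{A},UK}(x)-Z(x))^2\big]=k(x,x)+\alpha_{\mathcal{A},UK}(x)^tK_{UK,M}(x)\alpha_{\mathcal{A},UK}(x)-2\alpha_{\mathcal{A},UK}(x)^tk_{UK,M}(x).$$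
   Context: Notation: $k(A,B)$ is the matrix with entries $k(a_i,b_j)$ for matrices $A,B$ with rows $a_i^t,b_j^t$, and $f(A)$ is the column vector with entries $f(a_i)$. The matrix $X$ has rows $x_1^t,\dots,x_n^t$, and each $X_i$ is a submatrix made of a subset of the rows of $X$. With $n_i$ the number of points in $X_i$, $H_i$ is the $n_i\times m$ matrix $(h_1(X_i),\dots,h_m(X_i))$. The universal Kriging sub-model based on $Z(X_i)$, i.e. the best linear unbiased predictor of $Z(x)$ given $Z(X_i)$, is $$M_{UK,i}(x)=h(x)^t\hat\beta_i+k(x,X_i)k(X_i,X_i)^{-1}(Z(X_i)-H_i\hat\beta_i),\qquad \hat\beta_i=(H_i^tk(X_i,X_i)^{-1}H_i)^{-1}H_i^tk(X_i,X_i)^{-1}Z(X_i).$$ The matrices $k(X_i,X_i)$, $H_i^tk(X_i,X_i)^{-1}H_i$ and $K_{UK,M}(x)$, whose inverses appear in the formulas, are taken to be invertible.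
   Formalization: The smallest mean square error claim is stated only when h(x) is not the zero vector; if h(x)=0, every linear function of the sub-models is unbiased and weights not summing to one can do better, so the claim fails. All other conclusions are stated in full. *)

theory Defs
  imports
    "HOL-Probability.Probability"
    "Jordan_Normal_Form.Gauss_Jordan_Elimination"
    "Jordan_Normal_Form.DL_Submatrix"
begin

text \<open>All vectors and matrices are those of Jordan_Normal_Form, since the numbers of rows of the
  submatrices differ from one another.  Indices start from 0.\<close>

unbundle no inner_syntax
no_notation Finite_Cartesian_Product.vec_nth (infixl \<open>$\<close> 90)

section \<open>Gaussian processes\<close>

text \<open>Gaussian random variables may be degenerate: almost surely constant ones are included, so
  that covariance functions need only be positive semidefinite.\<close>

definition gaussian_rv :: "'a measure \<Rightarrow> ('a \<Rightarrow> real) \<Rightarrow> bool" where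
  "gaussian_rv M U \<longleftrightarrow> U \<in> borel_measurable M \<and>
     (\<exists>\<mu> \<sigma>. (\<sigma> > 0 \<and> distributed M lborel U (normal_density \<mu> \<sigma>)) \<or> (AE \<omega> in M. U \<omega> = \<mu>))"

definition gaussian_process :: "'a measure \<Rightarrow> 'i set \<Rightarrow> ('i \<Rightarrow> 'a \<Rightarrow> real) \<Rightarrow> bool" where
  "gaussian_process M D Y \<longleftrightarrow>
     (\<forall>S c. finite S \<and> S \<subseteq> D \<longrightarrow> gaussian_rv M (\<lambda>\<omega>. \<Sum>s\<in>S. c s * Y s \<omega>))"

definition centered_process :: "'a measure \<Rightarrow> 'i set \<Rightarrow> ('i \<Rightarrow> 'a \<Rightarrow> real) \<Rightarrow> bool" where
  "centered_process M D Y \<longleftrightarrow> (\<forall>s\<in>D. integral\<^sup>L M (Y s) = 0)"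

definition has_covariance_function ::
  "'a measure \<Rightarrow> 'i set \<Rightarrow> ('i \<Rightarrow> 'a \<Rightarrow> real) \<Rightarrow> ('i \<Rightarrow> 'i \<Rightarrow> real) \<Rightarrow> bool" where
  "has_covariance_function M D Y k \<longleftrightarrow>
     (\<forall>s\<in>D. \<forall>t\<in>D. k s t =
        (\<integral>\<omega>. (Y s \<omega> - integral\<^sup>L M (Y s)) * (Y t \<omega> - integral\<^sup>L M (Y t)) \<partial>M))"

section \<open>Matrix notation\<close>

text \<open>The library function returns an option; the value below is meaningful only for invertible
  matrices.\<close>

definition inv_mat :: "real mat \<Rightarrow> real mat" where
  "inv_mat A = the (mat_inverse A)"

text \<open>The product of a row vector with a matrix, again represented as a vector.\<close>

definition vec_mult_mat :: "real vec \<Rightarrow> real mat \<Rightarrow> real vec" (infixl \<open>\<^sub>v*\<close> 70) where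
  "v \<^sub>v* A = transpose_mat A *\<^sub>v v"

definition ones :: "nat \<Rightarrow> real vec" where
  "ones p = vec p (\<lambda>_. 1)"

definition eval_rows :: "(real vec \<Rightarrow> real) \<Rightarrow> real mat \<Rightarrow> real vec" where
  "eval_rows f A = vec (dim_row A) (\<lambda>i. f (row A i))"

definition cov_mat :: "(real vec \<Rightarrow> real vec \<Rightarrow> real) \<Rightarrow> real mat \<Rightarrow> real mat \<Rightarrow> real mat" where
  "cov_mat k A B = mat (dim_row A) (dim_row B) (\<lambda>(i, j). k (row A i) (row B j))"

definition trend_vec :: "nat \<Rightarrow> (nat \<Rightarrow> real vec \<Rightarrow> real) \<Rightarrow> real vec \<Rightarrow> real vec" where
  "trend_vec m h x = vec m (\<lambda>j. h j x)"

definition trend_mat :: "nat \<Rightarrow> (nat \<Rightarrow> real vec \<Rightarrow> real) \<Rightarrow> real mat \<Rightarrow> real mat" where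
  "trend_mat m h A = mat (dim_row A) m (\<lambda>(i, j). h j (row A i))"

definition linear_form :: "nat \<Rightarrow> (real vec \<Rightarrow> real) \<Rightarrow> bool" where
  "linear_form p L \<longleftrightarrow>
     (\<forall>u\<in>carrier_vec p. \<forall>v\<in>carrier_vec p. L (u + v) = L u + L v) \<and>
     (\<forall>c. \<forall>v\<in>carrier_vec p. L (c \<cdot>\<^sub>v v) = c * L v)"

section \<open>Universal Kriging\<close>

definition trend_process ::
  "nat \<Rightarrow> (nat \<Rightarrow> real vec \<Rightarrow> real) \<Rightarrow> (real vec \<Rightarrow> 'a \<Rightarrow> real) \<Rightarrow> real vec \<Rightarrow> real vec \<Rightarrow> 'a \<Rightarrow> real" where
  "trend_process m h Y \<beta> x \<omega> = (\<Sum>j<m. \<beta> $ j * h j x) + Y x \<omega>"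

definition gls_normal_mat ::
  "(real vec \<Rightarrow> real vec \<Rightarrow> real) \<Rightarrow> nat \<Rightarrow> (nat \<Rightarrow> real vec \<Rightarrow> real) \<Rightarrow> real mat \<Rightarrow> real mat" where
  "gls_normal_mat k m h A =
     transpose_mat (trend_mat m h A) * inv_mat (cov_mat k A A) * trend_mat m h A"

definition gls_estimate ::
  "(real vec \<Rightarrow> real vec \<Rightarrow> real) \<Rightarrow> nat \<Rightarrow> (nat \<Rightarrow> real vec \<Rightarrow> real) \<Rightarrow> real mat \<Rightarrow> real vec \<Rightarrow> real vec" where
  "gls_estimate k m h A z =
     (inv_mat (gls_normal_mat k m h A) * transpose_mat (trend_mat m h A) * inv_mat (cov_mat k A A))
       *\<^sub>v z"

text \<open>The universal Kriging predictor at x from the observed values z at the rows of A.\<close>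

definition uk_predictor ::
  "(real vec \<Rightarrow> real vec \<Rightarrow> real) \<Rightarrow> nat \<Rightarrow> (nat \<Rightarrow> real vec \<Rightarrow> real) \<Rightarrow> real mat \<Rightarrow> real vec
     \<Rightarrow> real vec \<Rightarrow> real" where
  "uk_predictor k m h A z x =
     trend_vec m h x \<bullet> gls_estimate k m h A z
     + (eval_rows (k x) A \<^sub>v* inv_mat (cov_mat k A A))
         \<bullet> (z - trend_mat m h A *\<^sub>v gls_estimate k m h A z)"

definition uk_weights ::
  "(real vec \<Rightarrow> real vec \<Rightarrow> real) \<Rightarrow> nat \<Rightarrow> (nat \<Rightarrow> real vec \<Rightarrow> real) \<Rightarrow> real mat \<Rightarrow> real vec
     \<Rightarrow> real vec" where
  "uk_weights k m h A x =
     (let H = trend_mat m h A;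
          Kinv = inv_mat (cov_mat k A A);
          Ginv = inv_mat (gls_normal_mat k m h A);
          kx = eval_rows (k x) A
      in trend_vec m h x \<^sub>v* (Ginv * transpose_mat H * Kinv)
         - kx \<^sub>v* (Kinv * H * Ginv * transpose_mat H * Kinv)
         + kx \<^sub>v* Kinv)"

text \<open>In the following, X i is the i-th submatrix of observation points, for i < p.\<close>

definition uk_submodels ::
  "(real vec \<Rightarrow> real vec \<Rightarrow> real) \<Rightarrow> nat \<Rightarrow> (nat \<Rightarrow> real vec \<Rightarrow> real) \<Rightarrow> nat \<Rightarrow> (nat \<Rightarrow> real mat)
     \<Rightarrow> real vec \<Rightarrow> (real vec \<Rightarrow> real) \<Rightarrow> real vec" where
  "uk_submodels k m h p X x z = vec p (\<lambda>i. uk_predictor k m h (X i) (eval_rows z (X i)) x)"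

definition uk_cov_mat ::
  "(real vec \<Rightarrow> real vec \<Rightarrow> real) \<Rightarrow> nat \<Rightarrow> (nat \<Rightarrow> real vec \<Rightarrow> real) \<Rightarrow> nat \<Rightarrow> (nat \<Rightarrow> real mat)
     \<Rightarrow> real vec \<Rightarrow> real mat" where
  "uk_cov_mat k m h p X x =
     mat p p (\<lambda>(i, j). (uk_weights k m h (X i) x \<^sub>v* cov_mat k (X i) (X j)) \<bullet> uk_weights k m h (X j) x)"

definition uk_cov_vec ::
  "(real vec \<Rightarrow> real vec \<Rightarrow> real) \<Rightarrow> nat \<Rightarrow> (nat \<Rightarrow> real vec \<Rightarrow> real) \<Rightarrow> nat \<Rightarrow> (nat \<Rightarrow> real mat)
     \<Rightarrow> real vec \<Rightarrow> real vec" where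
  "uk_cov_vec k m h p X x =
     vec p (\<lambda>i. uk_weights k m h (X i) x \<bullet> eval_rows (\<lambda>a. k a x) (X i))"

section \<open>Aggregation\<close>

text \<open>K and kM are the matrix and vector of covariances of the sub-models; v is the vector of
  sub-model values.\<close>

definition agg_mean :: "real mat \<Rightarrow> real vec \<Rightarrow> real" where
  "agg_mean K v =
     (let p = dim_vec v in
      inverse ((ones p \<^sub>v* inv_mat K) \<bullet> ones p) * ((ones p \<^sub>v* inv_mat K) \<bullet> v))"

definition agg_predictor :: "real mat \<Rightarrow> real vec \<Rightarrow> real vec \<Rightarrow> real" where
  "agg_predictor K kM v =
     agg_mean K v + (kM \<^sub>v* inv_mat K) \<bullet> (v - agg_mean K v \<cdot>\<^sub>v ones (dim_vec v))"

definition agg_weights :: "real mat \<Rightarrow> real vec \<Rightarrow> real vec" where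
  "agg_weights K kM =
     (let e = ones (dim_vec kM);
          c = inverse ((e \<^sub>v* inv_mat K) \<bullet> e)
      in c \<cdot>\<^sub>v (e \<^sub>v* inv_mat K)
         - (((kM \<^sub>v* inv_mat K) \<bullet> e) * c) \<cdot>\<^sub>v (e \<^sub>v* inv_mat K)
         + kM \<^sub>v* inv_mat K)"

section \<open>Predictors\<close>

text \<open>A predictor is a function L of the vector of sub-models V \<beta>, where V \<beta> and Z \<beta> are the
  random vector and the random variable to be predicted when the trend parameter is \<beta>.  As \<beta> is
  unknown, L is the same for all \<beta>.\<close>

definition unbiased_predictor ::
  "'a measure \<Rightarrow> nat \<Rightarrow> (real vec \<Rightarrow> 'a \<Rightarrow> real vec) \<Rightarrow> (real vec \<Rightarrow> 'a \<Rightarrow> real)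
     \<Rightarrow> (real vec \<Rightarrow> real) \<Rightarrow> bool" where
  "unbiased_predictor M m V Z L \<longleftrightarrow>
     (\<forall>\<beta>\<in>carrier_vec m. (\<integral>\<omega>. L (V \<beta> \<omega>) \<partial>M) = (\<integral>\<omega>. Z \<beta> \<omega> \<partial>M))"

definition mean_square_error ::
  "'a measure \<Rightarrow> (real vec \<Rightarrow> 'a \<Rightarrow> real vec) \<Rightarrow> (real vec \<Rightarrow> 'a \<Rightarrow> real)
     \<Rightarrow> (real vec \<Rightarrow> real) \<Rightarrow> real vec \<Rightarrow> real" where
  "mean_square_error M V Z L \<beta> = (\<integral>\<omega>. (L (V \<beta> \<omega>) - Z \<beta> \<omega>)\<^sup>2 \<partial>M)"

end

theory Submission
  imports Defs
begin

text \<open>The weights of each universal Kriging sub-model satisfy \<open>w_i(x)\<^sup>t H_i = h(x)\<^sup>t\<close>, so every sub-model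
  is the unknown mean \<open>h(x)\<^sup>t \<beta>\<close> of \<open>Z(x)\<close> plus a centered noise \<open>\<xi>_i = w_i(x)\<^sup>t Y(X_i)\<close>.  Aggregating
  them is therefore ordinary Kriging: when \<open>h(x) \<noteq> 0\<close>, a linear predictor with weights \<open>u\<close> is unbiased
  exactly if \<open>u\<^sup>t 1_p = 1\<close>, and its mean square error is then
  \<open>k(x,x) + u\<^sup>t K u - 2 u\<^sup>t k_M\<close>, free of \<open>\<beta>\<close>.  The aggregation weights satisfy the Lagrange
  condition \<open>K \<alpha> = k_M + \<mu> 1_p\<close>, and since \<open>K\<close> is positive semidefinite, they minimize that quadratic
  function under the constraint.\<close>

section \<open>Linear algebra\<close>

text \<open>Gauss-Jordan elimination returns \<open>None\<close> only for matrices that are not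
  units of the matrix ring, so it is enough to exhibit \<open>A\<close> as a unit.\<close>

lemma inv_mat_inverse:
  assumes A: "A \<in> carrier_mat n n" and inv: "invertible_mat A"
  shows inv_mat_carrier: "inv_mat A \<in> carrier_mat n n"
    and mult_inv_mat: "A * inv_mat A = 1\<^sub>m n"
    and inv_mat_mult: "inv_mat A * A = 1\<^sub>m n"
proof -
  obtain B where B: "A * B = 1\<^sub>m n" "B * A = 1\<^sub>m (dim_row B)"
    using A inv unfolding invertible_mat_def inverts_mat_def by auto
  \<comment> \<open>Invertibility leaves the dimensions of \<open>B\<close> open; comparing the
    numbers of columns in both products forces them to be \<open>n\<close>.\<close>
  have "dim_col B = n"
    using arg_cong[OF B(1), of dim_col] by simp
  moreover have "dim_row B = n"
    using A arg_cong[OF B(2), of dim_col] by simp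
  ultimately have "B \<in> carrier_mat n n" "B * A = 1\<^sub>m n"
    using B(2) by auto
  with A B(1) have "A \<in> Units (ring_mat TYPE(real) n ())"
    unfolding Units_def ring_mat_def by auto
  then obtain C where "mat_inverse A = Some C"
    using mat_inverse(1)[OF A, of "()"] by (cases "mat_inverse A") auto
  with mat_inverse(2)[OF A] show "inv_mat A \<in> carrier_mat n n"
    "A * inv_mat A = 1\<^sub>m n" "inv_mat A * A = 1\<^sub>m n"
    by (auto simp: inv_mat_def)
qed

lemma inv_mat_mult_vec:
  assumes "A \<in> carrier_mat n n" "invertible_mat A" "v \<in> carrier_vec n"
  shows mult_inv_mat_vec: "A *\<^sub>v (inv_mat A *\<^sub>v v) = v"
    and inv_mat_mult_mat_vec: "inv_mat A *\<^sub>v (A *\<^sub>v v) = v"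
proof -
  note J = inv_mat_inverse[OF assms(1,2)]
  show "A *\<^sub>v (inv_mat A *\<^sub>v v) = v"
    using assoc_mult_mat_vec[OF assms(1) J(1) assms(3)] assms(3) by (simp add: J(2))
  show "inv_mat A *\<^sub>v (A *\<^sub>v v) = v"
    using assoc_mult_mat_vec[OF J(1) assms(1,3)] assms(3) by (simp add: J(3))
qed

text \<open>Transposing \<open>A * inv_mat A = 1\<close> shows that the transposed inverse is a left
  inverse of the symmetric \<open>A\<close>, and a left inverse equals a right inverse.\<close>

lemma transpose_inv_mat_symmetric:
  assumes A: "A \<in> carrier_mat n n" and inv: "invertible_mat A"
    and sym: "transpose_mat A = A"
  shows "transpose_mat (inv_mat A) = inv_mat A"
proof -
  note J = inv_mat_inverse[OF A inv]
  let ?J = "inv_mat A"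
  have "transpose_mat ?J * A = 1\<^sub>m n"
    using arg_cong[OF J(2), of transpose_mat] transpose_mult[OF A J(1)] sym by simp
  then have "transpose_mat ?J * (A * ?J) = ?J"
    using assoc_mult_mat[of "transpose_mat ?J" n n A n ?J n] A J(1) by simp
  then show ?thesis
    using J(1) by (simp add: J(2))
qed

lemma vec_mult_mat_carrier:
  "A \<in> carrier_mat nr nc \<Longrightarrow> v \<^sub>v* A \<in> carrier_vec nc"
  unfolding vec_mult_mat_def by (intro carrier_vecI) simp

lemma vec_mult_mat_scalar_prod:
  assumes "A \<in> carrier_mat nr nc" "v \<in> carrier_vec nr" "u \<in> carrier_vec nc"
  shows "(v \<^sub>v* A) \<bullet> u = v \<bullet> (A *\<^sub>v u)"
  unfolding vec_mult_mat_def by (rule transpose_vec_mult_scalar[OF assms(1,3,2)])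

lemma ones_carrier [simp]: "ones p \<in> carrier_vec p"
  by (simp add: ones_def)

section \<open>Linear forms as scalar products\<close>

lemma linear_form_scalar_prodI:
  assumes u: "u \<in> carrier_vec p" and L: "\<And>v. v \<in> carrier_vec p \<Longrightarrow> L v = u \<bullet> v"
  shows "linear_form p L"
  unfolding linear_form_def
proof (intro conjI ballI allI)
  fix v w :: "real vec" and c :: real
  assume v: "v \<in> carrier_vec p"
  show "L (c \<cdot>\<^sub>v v) = c * L v"
    using L[of v] L[of "c \<cdot>\<^sub>v v"] u v by simp
  assume w: "w \<in> carrier_vec p"
  show "L (v + w) = L v + L w"
    using L[of v] L[of w] L[of "v + w"] scalar_prod_add_distrib[OF u v w] v w by simp
qed

text \<open>The weights are the values of \<open>L\<close> on the unit vectors. This turns every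
  competing linear predictor into a weight vector.\<close>

lemma linear_form_eq_scalar_prod:
  assumes L: "linear_form p L"
  obtains u where "u \<in> carrier_vec p" "\<And>v. v \<in> carrier_vec p \<Longrightarrow> L v = u \<bullet> v"
proof
  let ?u = "vec p (\<lambda>i. L (unit_vec p i))"
  show "?u \<in> carrier_vec p" by simp
  fix v :: "real vec" assume v: "v \<in> carrier_vec p"
  \<comment> \<open>Additivity is available for two vectors at a time, so \<open>v\<close> is built
    up coordinate by coordinate from its truncations; homogeneity with scalar 0 settles the empty
    truncation.\<close>
  have partial: "q \<le> p \<Longrightarrow> L (vec p (\<lambda>i. if i < q then v $ i else 0)) =
      (\<Sum>i<q. L (unit_vec p i) * v $ i)" for q
  proof (induction q)
    case 0
    have "L (0 \<cdot>\<^sub>v 0\<^sub>v p) = 0 * L (0\<^sub>v p)"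
      using L unfolding linear_form_def by (metis zero_carrier_vec)
    moreover have "0 \<cdot>\<^sub>v 0\<^sub>v p = (vec p (\<lambda>i. 0) :: real vec)" by (intro eq_vecI) auto
    ultimately show ?case by simp
  next
    case (Suc q)
    have "vec p (\<lambda>i. if i < Suc q then v $ i else 0) =
        vec p (\<lambda>i. if i < q then v $ i else 0) + v $ q \<cdot>\<^sub>v unit_vec p q"
      using Suc.prems by (intro eq_vecI) (auto simp: unit_vec_def less_Suc_eq)
    then show ?case
      using Suc L by (simp add: linear_form_def)
  qed
  have "vec p (\<lambda>i. if i < p then v $ i else 0) = v"
    using v by (intro eq_vecI) auto
  then show "L v = ?u \<bullet> v"
    using partial[of p] v by (simp add: scalar_prod_def lessThan_atLeast0)
qed

section \<open>Quadratic forms of symmetric matrices\<close>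

lemma symmetric_scalar_prod_mult:
  fixes A :: "real mat"
  assumes "A \<in> carrier_mat n n" "transpose_mat A = A" "u \<in> carrier_vec n" "v \<in> carrier_vec n"
  shows "u \<bullet> (A *\<^sub>v v) = v \<bullet> (A *\<^sub>v u)"
proof -
  have "u \<bullet> (A *\<^sub>v v) = (A *\<^sub>v u) \<bullet> v"
    using transpose_vec_mult_scalar[of A n n v u] assms by simp
  also have "\<dots> = v \<bullet> (A *\<^sub>v u)"
    using assms by (simp add: comm_scalar_prod[of _ n])
  finally show ?thesis .
qed

lemma quadratic_form_add:
  fixes A :: "real mat"
  assumes "A \<in> carrier_mat n n" "transpose_mat A = A" "u \<in> carrier_vec n" "v \<in> carrier_vec n"
  shows "(u + v) \<bullet> (A *\<^sub>v (u + v)) = u \<bullet> (A *\<^sub>v u) + 2 * (v \<bullet> (A *\<^sub>v u)) + v \<bullet> (A *\<^sub>v v)"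
proof -
  have Au: "A *\<^sub>v u \<in> carrier_vec n" and Av: "A *\<^sub>v v \<in> carrier_vec n"
    using assms by auto
  have "(u + v) \<bullet> (A *\<^sub>v (u + v)) = u \<bullet> (A *\<^sub>v u) + u \<bullet> (A *\<^sub>v v) + (v \<bullet> (A *\<^sub>v u) + v \<bullet> (A *\<^sub>v v))"
    using assms(3,4) Au Av
    by (simp add: mult_add_distrib_mat_vec[OF assms(1,3,4)] add_scalar_prod_distrib[OF assms(3,4)]
        scalar_prod_add_distrib[OF _ Au Av])
  then show ?thesis
    using symmetric_scalar_prod_mult[OF assms] by linarith
qed

text \<open>Moving from \<open>u\<close> in the direction \<open>v = A u\<close> by a factor
  \<open>t\<close> changes the form from 0 to \<open>2 * t * b + t\<^sup>2 * q\<close> with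
  \<open>b = v \<bullet> v\<close>. If \<open>b\<close> were positive, the linear term would make
  this negative for some negative \<open>t\<close>.\<close>

lemma psd_quadratic_form_zero:
  fixes A :: "real mat"
  assumes A: "A \<in> carrier_mat n n" "transpose_mat A = A"
    and psd: "\<And>v. v \<in> carrier_vec n \<Longrightarrow> 0 \<le> v \<bullet> (A *\<^sub>v v)"
    and u: "u \<in> carrier_vec n" "u \<bullet> (A *\<^sub>v u) = 0"
  shows "A *\<^sub>v u = 0\<^sub>v n"
proof -
  define v where "v = A *\<^sub>v u"
  have v: "v \<in> carrier_vec n" using A u by (simp add: v_def)
  define b q where "b = v \<bullet> v" and "q = v \<bullet> (A *\<^sub>v v)"
  have quad: "0 \<le> 2 * t * b + t\<^sup>2 * q" for t
  proof -
    have "0 \<le> (u + t \<cdot>\<^sub>v v) \<bullet> (A *\<^sub>v (u + t \<cdot>\<^sub>v v))"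
      using u v by (intro psd) auto
    also have "\<dots> = 2 * t * b + t\<^sup>2 * q"
      using quadratic_form_add[OF A, of u "t \<cdot>\<^sub>v v"] A u v
      by (simp add: b_def q_def v_def[symmetric] mult_mat_vec[of _ n n] power2_eq_square
          del: smult_scalar_prod_distrib scalar_prod_smult_distrib)
    finally show ?thesis .
  qed
  have "q \<ge> 0" using psd v by (simp add: q_def)
  have "b \<ge> 0" by (simp add: b_def scalar_prod_def sum_nonneg)
  have "b = 0"
  proof (rule ccontr)
    assume "b \<noteq> 0"
    with \<open>b \<ge> 0\<close> have "b > 0" by simp
    \<comment> \<open>The parabola has its minimum at \<open>- b / q\<close>; the denominator
      \<open>q + 1\<close> stays positive even when \<open>q = 0\<close> and still yields a negative
      value.\<close>
    have "2 * (- b / (q + 1)) * b + (- b / (q + 1))\<^sup>2 * q = - (b\<^sup>2 * (q + 2) / (q + 1)\<^sup>2)"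
    proof -
      define c where "c = b / (q + 1)"
      have "b = c * (q + 1)" using \<open>q \<ge> 0\<close> by (simp add: c_def)
      then have "2 * (- c) * b + (- c)\<^sup>2 * q = - (c\<^sup>2 * (q + 2))"
        by (simp add: algebra_simps power2_eq_square)
      then show ?thesis by (simp add: c_def power_divide)
    qed
    also have "\<dots> < 0" using \<open>q \<ge> 0\<close> \<open>b > 0\<close> by (simp add: divide_pos_pos)
    finally show False using quad[of "- b / (q + 1)"] by simp
  qed
  then have "\<forall>i<n. v $ i = 0"
    using v by (auto simp: b_def scalar_prod_def sum_nonneg_eq_0_iff)
  then show ?thesis using v by (auto simp: v_def[symmetric] intro!: eq_vecI)
qed

section \<open>Aggregation weights\<close>

text \<open>The estimated mean is itself linear in \<open>v\<close>, namely
  \<open>c * (r \<bullet> v)\<close>; substituting it and collecting the factors of \<open>v\<close>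
  leaves the weight vector.\<close>

lemma agg_predictor_eq_scalar_prod:
  assumes K: "K \<in> carrier_mat p p" "invertible_mat K"
    and kM: "kM \<in> carrier_vec p" and v: "v \<in> carrier_vec p"
  shows "agg_predictor K kM v = agg_weights K kM \<bullet> v"
proof -
  define e where "e = ones p"
  define r g where "r = e \<^sub>v* inv_mat K" and "g = kM \<^sub>v* inv_mat K"
  define c where "c = inverse (r \<bullet> e)"
  note J = inv_mat_carrier[OF K]
  have e: "e \<in> carrier_vec p" by (simp add: e_def)
  have r: "r \<in> carrier_vec p" and g: "g \<in> carrier_vec p"
    unfolding r_def g_def by (rule vec_mult_mat_carrier[OF J])+
  have dims: "dim_vec v = p" "dim_vec kM = p" using v kM by auto
  have "agg_mean K v = c * (r \<bullet> v)"
    by (simp add: agg_mean_def dims Let_def e_def c_def r_def)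
  then have "agg_predictor K kM v = c * (r \<bullet> v) + g \<bullet> (v - (c * (r \<bullet> v)) \<cdot>\<^sub>v e)"
    by (simp add: agg_predictor_def dims e_def g_def)
  also have "\<dots> = c * (r \<bullet> v) + (g \<bullet> v - c * (r \<bullet> v) * (g \<bullet> e))"
    using scalar_prod_minus_distrib[OF g v, of "(c * (r \<bullet> v)) \<cdot>\<^sub>v e"] e g by simp
  also have "\<dots> = (c \<cdot>\<^sub>v r - ((g \<bullet> e) * c) \<cdot>\<^sub>v r + g) \<bullet> v"
    using r g v
    by (simp add: add_scalar_prod_distrib[of _ p] minus_scalar_prod_distrib[of _ p])
  also have "\<dots> = agg_weights K kM \<bullet> v"
    by (simp add: agg_weights_def dims Let_def e_def c_def r_def g_def)
  finally show ?thesis .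
qed

text \<open>By symmetry of the inverse the weights are \<open>g + \<mu> r\<close>, where
  \<open>r\<close> and \<open>g\<close> solve \<open>K r = 1\<close> and \<open>K g = kM\<close>.
  Multiplying by \<open>K\<close> gives the Lagrange condition. The hypothesis \<open>s\<close>
  makes \<open>c\<close> a genuine reciprocal.\<close>

lemma agg_weights:
  assumes K: "K \<in> carrier_mat p p" "invertible_mat K" "transpose_mat K = K"
    and kM: "kM \<in> carrier_vec p"
    and s: "ones p \<bullet> (inv_mat K *\<^sub>v ones p) \<noteq> 0"
  shows agg_weights_carrier: "agg_weights K kM \<in> carrier_vec p"
    and agg_weights_sum: "agg_weights K kM \<bullet> ones p = 1"
    and agg_weights_normal_equation: "\<exists>\<mu>. K *\<^sub>v agg_weights K kM = kM + \<mu> \<cdot>\<^sub>v ones p"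
proof -
  define e where "e = ones p"
  define r g where "r = inv_mat K *\<^sub>v e" and "g = inv_mat K *\<^sub>v kM"
  define c where "c = inverse (r \<bullet> e)"
  \<comment> \<open>The Lagrange multiplier: \<open>(1 - g \<bullet> e) / (r \<bullet> e)\<close> is
    the multiple of \<open>r\<close> that makes the weights sum to one.\<close>
  define \<mu> where "\<mu> = c - (g \<bullet> e) * c"
  note J = inv_mat_carrier[OF K(1,2)]
  have e: "e \<in> carrier_vec p" by (simp add: e_def)
  have r: "r \<in> carrier_vec p" and g: "g \<in> carrier_vec p"
    unfolding r_def g_def by (rule mult_mat_vec_carrier[OF J], rule e kM)+
  have re: "r \<bullet> e \<noteq> 0"
    using s comm_scalar_prod[OF e r] by (simp add: e_def r_def)
  have dims: "dim_vec kM = p" using kM by auto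
  have sym: "u \<^sub>v* inv_mat K = inv_mat K *\<^sub>v u" for u
    by (simp add: vec_mult_mat_def transpose_inv_mat_symmetric[OF K])
  have "agg_weights K kM = c \<cdot>\<^sub>v r - ((g \<bullet> e) * c) \<cdot>\<^sub>v r + g"
    by (simp add: agg_weights_def dims Let_def sym e_def c_def r_def g_def)
  also have "\<dots> = g + \<mu> \<cdot>\<^sub>v r"
    using r g by (intro eq_vecI) (auto simp: \<mu>_def algebra_simps)
  finally have \<alpha>: "agg_weights K kM = g + \<mu> \<cdot>\<^sub>v r" .
  show "agg_weights K kM \<in> carrier_vec p"
    using r g by (simp add: \<alpha>)
  have "(g + \<mu> \<cdot>\<^sub>v r) \<bullet> e = g \<bullet> e + \<mu> * (r \<bullet> e)"
    using r g e by (simp add: add_scalar_prod_distrib[of _ p])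
  also have "\<dots> = 1"
    using re by (simp add: \<mu>_def c_def field_simps)
  finally show "agg_weights K kM \<bullet> ones p = 1"
    by (simp add: \<alpha> e_def)
  have "K *\<^sub>v (g + \<mu> \<cdot>\<^sub>v r) = K *\<^sub>v g + \<mu> \<cdot>\<^sub>v (K *\<^sub>v r)"
    using mult_add_distrib_mat_vec[OF K(1) g, of "\<mu> \<cdot>\<^sub>v r"] mult_mat_vec[OF K(1) r] r by simp
  also have "\<dots> = kM + \<mu> \<cdot>\<^sub>v ones p"
    using mult_inv_mat_vec[OF K(1,2)] kM e by (simp add: g_def r_def e_def)
  finally show "\<exists>\<mu>. K *\<^sub>v agg_weights K kM = kM + \<mu> \<cdot>\<^sub>v ones p"
    unfolding \<alpha> by blast
qed

text \<open>Put \<delta> = \<open>u - a\<close>. The constraint makes \<delta> orthogonal to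
  \<open>e\<close>, so \<mu> drops out and the first-order terms cancel; the right side exceeds the
  left by exactly \<open>\<delta> \<bullet> (K *\<^sub>v \<delta>)\<close>, which is
  nonnegative.\<close>

lemma normal_equation_optimal:
  fixes K :: "real mat"
  assumes K: "K \<in> carrier_mat p p" "transpose_mat K = K"
    and psd: "\<And>v. v \<in> carrier_vec p \<Longrightarrow> 0 \<le> v \<bullet> (K *\<^sub>v v)"
    and carrier: "a \<in> carrier_vec p" "u \<in> carrier_vec p" "b \<in> carrier_vec p" "e \<in> carrier_vec p"
    and normal: "K *\<^sub>v a = b + \<mu> \<cdot>\<^sub>v e" and constraint: "u \<bullet> e = a \<bullet> e"
  shows "a \<bullet> (K *\<^sub>v a) - 2 * (a \<bullet> b) \<le> u \<bullet> (K *\<^sub>v u) - 2 * (u \<bullet> b)"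
proof -
  define \<delta> where "\<delta> = u - a"
  have \<delta>: "\<delta> \<in> carrier_vec p" using carrier by (simp add: \<delta>_def)
  have u: "u = a + \<delta>" using carrier by (intro eq_vecI) (auto simp: \<delta>_def)
  have "\<delta> \<bullet> e = 0"
    using minus_scalar_prod_distrib[OF carrier(2,1,4)] constraint by (simp add: \<delta>_def)
  then have "\<delta> \<bullet> (K *\<^sub>v a) = \<delta> \<bullet> b"
    using scalar_prod_add_distrib[OF \<delta> carrier(3), of "\<mu> \<cdot>\<^sub>v e"] carrier \<delta> by (simp add: normal)
  moreover have "u \<bullet> b = a \<bullet> b + \<delta> \<bullet> b"
    unfolding u by (rule add_scalar_prod_distrib[OF carrier(1) \<delta> carrier(3)])
  ultimately show ?thesis
    using quadratic_form_add[OF K carrier(1) \<delta>] psd[OF \<delta>] by (simp flip: u)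
qed

text \<open>If the number vanished, the quadratic form of \<open>K\<close> would vanish at
  \<open>?r\<close>, hence \<open>K\<close> would send \<open>?r\<close> to zero. But it sends
  \<open>?r\<close> to \<open>ones p\<close>, which is nonzero since
  \<open>p \<ge> 1\<close>.\<close>

lemma psd_inv_mat_ones_nonzero:
  assumes K: "K \<in> carrier_mat p p" "invertible_mat K" "transpose_mat K = K"
    and psd: "\<And>v. v \<in> carrier_vec p \<Longrightarrow> 0 \<le> v \<bullet> (K *\<^sub>v v)" and p: "p \<ge> 1"
  shows "ones p \<bullet> (inv_mat K *\<^sub>v ones p) \<noteq> 0"
proof
  let ?r = "inv_mat K *\<^sub>v ones p"
  assume "ones p \<bullet> ?r = 0"
  have r: "?r \<in> carrier_vec p"
    using inv_mat_carrier[OF K(1,2)] by simp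
  have Kr: "K *\<^sub>v ?r = ones p"
    using mult_inv_mat_vec[OF K(1,2)] by simp
  have "?r \<bullet> (K *\<^sub>v ?r) = 0"
    unfolding Kr using \<open>ones p \<bullet> ?r = 0\<close> comm_scalar_prod[OF r ones_carrier] by simp
  then have "ones p = 0\<^sub>v p"
    using psd_quadratic_form_zero[OF K(1,3) psd r] Kr by simp
  then have "ones p $ 0 = 0\<^sub>v p $ 0" by simp
  with p show False by (simp add: ones_def)
qed

section \<open>Universal Kriging sub-models\<close>

text \<open>Side conditions on dimensions instead of carriers let the simplifier reassociate long
  products with the help of \<open>uk_dims\<close>.\<close>

lemma mult_mat_vec_assoc_dim:
  "dim_col A = dim_row B \<Longrightarrow> dim_vec v = dim_col B \<Longrightarrow> (A * B) *\<^sub>v v = A *\<^sub>v (B *\<^sub>v v)"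
  by (rule assoc_mult_mat_vec[of A "dim_row A" "dim_row B" B "dim_col B" v]) (auto intro: carrier_vecI)

section \<open>Weights of a single sub-model\<close>

context
  fixes k m h A r d
  assumes A: "A \<in> carrier_mat r d"
    and inv_cov: "invertible_mat (cov_mat k A A)"
    and inv_gls: "invertible_mat (gls_normal_mat k m h A)"
begin

lemma cov_mat_carrier: "cov_mat k A A \<in> carrier_mat r r"
  using A by (auto simp: cov_mat_def)

lemma trend_mat_carrier: "trend_mat m h A \<in> carrier_mat r m"
  using A by (auto simp: trend_mat_def)

lemma gls_normal_mat_carrier: "gls_normal_mat k m h A \<in> carrier_mat m m"
  by (auto simp: gls_normal_mat_def trend_mat_def)

lemma uk_dims:
  "dim_row (inv_mat (cov_mat k A A)) = r" "dim_col (inv_mat (cov_mat k A A)) = r"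
  "dim_row (trend_mat m h A) = r" "dim_col (trend_mat m h A) = m"
  "dim_row (inv_mat (gls_normal_mat k m h A)) = m" "dim_col (inv_mat (gls_normal_mat k m h A)) = m"
  using trend_mat_carrier inv_mat_carrier[OF cov_mat_carrier inv_cov]
    inv_mat_carrier[OF gls_normal_mat_carrier inv_gls] by auto

lemma gls_estimate_carrier: "gls_estimate k m h A z \<in> carrier_vec m"
  by (intro carrier_vecI) (simp add: gls_estimate_def uk_dims)

text \<open>On data without noise, the factors to the right of the inverted normal matrix recombine
  to that matrix applied to \<beta>, so the inverse recovers \<beta>.\<close>

lemma gls_estimate_trend:
  assumes "\<beta> \<in> carrier_vec m"
  shows "gls_estimate k m h A (trend_mat m h A *\<^sub>v \<beta>) = \<beta>"
proof -
  have "gls_normal_mat k m h A *\<^sub>v \<beta> =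
      transpose_mat (trend_mat m h A) *\<^sub>v
        (inv_mat (cov_mat k A A) *\<^sub>v (trend_mat m h A *\<^sub>v \<beta>))"
    using assms by (simp add: gls_normal_mat_def mult_mat_vec_assoc_dim uk_dims)
  then have "gls_estimate k m h A (trend_mat m h A *\<^sub>v \<beta>) =
      inv_mat (gls_normal_mat k m h A) *\<^sub>v (gls_normal_mat k m h A *\<^sub>v \<beta>)"
    by (simp add: gls_estimate_def mult_mat_vec_assoc_dim uk_dims)
  then show ?thesis
    using inv_mat_mult_mat_vec[OF gls_normal_mat_carrier inv_gls assms] by simp
qed

lemma uk_weights_carrier: "uk_weights k m h A x \<in> carrier_vec r"
  by (intro carrier_vecI) (simp add: uk_weights_def Let_def vec_mult_mat_def uk_dims)

text \<open>Common source of the two facts below: the predictor formula, and the exactness of the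
  weights on pure trends.\<close>

lemma uk_weights_scalar_prod:
  assumes z: "z \<in> carrier_vec r"
  shows "uk_weights k m h A x \<bullet> z =
    trend_vec m h x \<bullet> gls_estimate k m h A z
    - (eval_rows (k x) A \<^sub>v* inv_mat (cov_mat k A A)) \<bullet> (trend_mat m h A *\<^sub>v gls_estimate k m h A z)
    + (eval_rows (k x) A \<^sub>v* inv_mat (cov_mat k A A)) \<bullet> z"
proof -
  define H Kinv Ginv where "H = trend_mat m h A" and "Kinv = inv_mat (cov_mat k A A)"
    and "Ginv = inv_mat (gls_normal_mat k m h A)"
  define B where "B = Ginv * transpose_mat H * Kinv"
  define C where "C = Kinv * H * Ginv * transpose_mat H * Kinv"
  define kx where "kx = eval_rows (k x) A"
  have dims: "dim_row H = r" "dim_col H = m" "dim_row Kinv = r" "dim_col Kinv = r"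
    "dim_row Ginv = m" "dim_col Ginv = m"
    by (simp_all add: H_def Kinv_def Ginv_def uk_dims)
  have B: "B \<in> carrier_mat m r" and C: "C \<in> carrier_mat r r" and Kinv: "Kinv \<in> carrier_mat r r"
    by (auto simp: B_def C_def dims)
  have kx: "kx \<in> carrier_vec r" using A by (auto simp: kx_def eval_rows_def)
  have hx: "trend_vec m h x \<in> carrier_vec m" by (simp add: trend_vec_def)
  have b: "gls_estimate k m h A z = B *\<^sub>v z"
    by (simp add: gls_estimate_def B_def H_def Kinv_def Ginv_def)
  have HB: "H *\<^sub>v (B *\<^sub>v z) \<in> carrier_vec r"
    by (intro carrier_vecI) (simp add: dims)
  \<comment> \<open>As maps on \<open>z\<close>, the five factors of \<open>C\<close> split into
    \<open>Kinv\<close>, \<open>H\<close> and the three factors of \<open>B\<close>, so the estimate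
    reappears inside.\<close>
  have Cz: "C *\<^sub>v z = Kinv *\<^sub>v (H *\<^sub>v (B *\<^sub>v z))"
    using z by (simp add: C_def B_def mult_mat_vec_assoc_dim dims)
  have "uk_weights k m h A x \<bullet> z = (trend_vec m h x \<^sub>v* B - kx \<^sub>v* C + kx \<^sub>v* Kinv) \<bullet> z"
    by (simp add: uk_weights_def Let_def B_def C_def H_def Kinv_def Ginv_def kx_def)
  also have "\<dots> = (trend_vec m h x \<^sub>v* B) \<bullet> z - (kx \<^sub>v* C) \<bullet> z + (kx \<^sub>v* Kinv) \<bullet> z"
    using vec_mult_mat_carrier[OF B] vec_mult_mat_carrier[OF C] vec_mult_mat_carrier[OF Kinv] z
    by (simp add: add_scalar_prod_distrib[of _ r] minus_scalar_prod_distrib[of _ r])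
  also have "(trend_vec m h x \<^sub>v* B) \<bullet> z = trend_vec m h x \<bullet> (B *\<^sub>v z)"
    by (rule vec_mult_mat_scalar_prod[OF B hx z])
  also have "(kx \<^sub>v* C) \<bullet> z = (kx \<^sub>v* Kinv) \<bullet> (H *\<^sub>v (B *\<^sub>v z))"
    using vec_mult_mat_scalar_prod[OF C kx z] vec_mult_mat_scalar_prod[OF Kinv kx HB]
    by (simp add: Cz)
  finally show ?thesis
    by (simp add: b H_def Kinv_def kx_def)
qed

lemma uk_predictor_eq_weights:
  assumes z: "z \<in> carrier_vec r"
  shows "uk_predictor k m h A z x = uk_weights k m h A x \<bullet> z"
proof -
  define g where "g = eval_rows (k x) A \<^sub>v* inv_mat (cov_mat k A A)"
  have g: "g \<in> carrier_vec r"
    unfolding g_def by (rule vec_mult_mat_carrier[OF inv_mat_carrier[OF cov_mat_carrier inv_cov]])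
  have "trend_mat m h A *\<^sub>v gls_estimate k m h A z \<in> carrier_vec r"
    by (rule mult_mat_vec_carrier[OF trend_mat_carrier gls_estimate_carrier])
  from scalar_prod_minus_distrib[OF g z this] show ?thesis
    by (simp add: uk_predictor_def uk_weights_scalar_prod[OF z] flip: g_def)
qed

text \<open>The estimate from a pure trend is \<beta> itself, so the two correction terms cancel.
  This is what makes each sub-model unbiased.\<close>

lemma uk_weights_trend:
  assumes \<beta>: "\<beta> \<in> carrier_vec m"
  shows "uk_weights k m h A x \<bullet> (trend_mat m h A *\<^sub>v \<beta>) = trend_vec m h x \<bullet> \<beta>"
  using uk_weights_scalar_prod[OF mult_mat_vec_carrier[OF trend_mat_carrier \<beta>]]
  by (simp add: gls_estimate_trend[OF \<beta>])

end

section \<open>Second moments\<close>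

lemma gaussian_rv_square_integrable:
  assumes "prob_space M" "gaussian_rv M U"
  shows "integrable M (\<lambda>\<omega>. (U \<omega>)\<^sup>2)"
proof -
  interpret prob_space M by fact
  have U: "U \<in> borel_measurable M"
    using assms by (simp add: gaussian_rv_def)
  from assms obtain \<mu> \<sigma> where
    "\<sigma> > 0 \<and> distributed M lborel U (normal_density \<mu> \<sigma>) \<or> (AE \<omega> in M. U \<omega> = \<mu>)"
    unfolding gaussian_rv_def by blast
  then show ?thesis
  proof
    assume \<sigma>: "\<sigma> > 0 \<and> distributed M lborel U (normal_density \<mu> \<sigma>)"
    \<comment> \<open>The known normal moments are centered at \<mu>, so the square of
      \<open>x\<close> is expanded in powers of \<open>x - \<mu>\<close>.\<close>
    have "integrable lborel (\<lambda>x. normal_density \<mu> \<sigma> x * (x - \<mu>)^2 +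
        2 * \<mu> * (normal_density \<mu> \<sigma> x * (x - \<mu>)^1) + \<mu>\<^sup>2 * (normal_density \<mu> \<sigma> x * (x - \<mu>)^0))"
      using \<sigma> by (intro Bochner_Integration.integrable_add integrable_mult_right
          integrable_normal_moment) auto
    also have "(\<lambda>x. normal_density \<mu> \<sigma> x * (x - \<mu>)^2 +
        2 * \<mu> * (normal_density \<mu> \<sigma> x * (x - \<mu>)^1) + \<mu>\<^sup>2 * (normal_density \<mu> \<sigma> x * (x - \<mu>)^0)) =
        (\<lambda>x. normal_density \<mu> \<sigma> x * x\<^sup>2)"
      by (intro ext) (simp add: algebra_simps power2_eq_square)
    finally show ?thesis
      using distributed_integrable[of M lborel U "normal_density \<mu> \<sigma>" "\<lambda>x. x\<^sup>2"] \<sigma> by simp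
  next
    assume "AE \<omega> in M. U \<omega> = \<mu>"
    then have "AE \<omega> in M. (U \<omega>)\<^sup>2 = \<mu>\<^sup>2" by eventually_elim simp
    with U have "integrable M (\<lambda>\<omega>. (U \<omega>)\<^sup>2) \<longleftrightarrow> integrable M (\<lambda>\<omega>. \<mu>\<^sup>2)"
      by (intro integrable_cong_AE) auto
    then show ?thesis by simp
  qed
qed

text \<open>The product is dominated by the sum of the two squares.\<close>

lemma integrable_mult_square_integrable:
  fixes f g :: "'a \<Rightarrow> real"
  assumes [measurable]: "f \<in> borel_measurable M" "g \<in> borel_measurable M"
    and "integrable M (\<lambda>\<omega>. (f \<omega>)\<^sup>2)" "integrable M (\<lambda>\<omega>. (g \<omega>)\<^sup>2)"
  shows "integrable M (\<lambda>\<omega>. f \<omega> * g \<omega>)"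
proof (rule Bochner_Integration.integrable_bound)
  show "integrable M (\<lambda>\<omega>. (f \<omega>)\<^sup>2 + (g \<omega>)\<^sup>2)"
    using assms by simp
  have "\<bar>a * b\<bar> \<le> a\<^sup>2 + b\<^sup>2" for a b :: real
    using sum_squares_bound[of "\<bar>a\<bar>" "\<bar>b\<bar>"] abs_ge_zero[of "a * b"]
    by (simp only: power2_abs abs_mult)
  then show "AE \<omega> in M. norm (f \<omega> * g \<omega>) \<le> norm ((f \<omega>)\<^sup>2 + (g \<omega>)\<^sup>2)"
    by simp
qed simp

lemma integral_sum_mult_sum:
  fixes f :: "'i \<Rightarrow> 'a \<Rightarrow> real" and g :: "'j \<Rightarrow> 'a \<Rightarrow> real"
  assumes "\<And>i j. i \<in> S \<Longrightarrow> j \<in> T \<Longrightarrow> integrable M (\<lambda>\<omega>. f i \<omega> * g j \<omega>)"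
  shows integrable_sum_mult_sum:
      "integrable M (\<lambda>\<omega>. (\<Sum>i\<in>S. a i * f i \<omega>) * (\<Sum>j\<in>T. b j * g j \<omega>))"
    and "(\<integral>\<omega>. (\<Sum>i\<in>S. a i * f i \<omega>) * (\<Sum>j\<in>T. b j * g j \<omega>) \<partial>M) =
      (\<Sum>i\<in>S. \<Sum>j\<in>T. a i * b j * (\<integral>\<omega>. f i \<omega> * g j \<omega> \<partial>M))"
proof -
  have eq: "(\<Sum>i\<in>S. a i * f i \<omega>) * (\<Sum>j\<in>T. b j * g j \<omega>) =
      (\<Sum>i\<in>S. \<Sum>j\<in>T. a i * b j * (f i \<omega> * g j \<omega>))" for \<omega>
    by (simp add: sum_product algebra_simps)
  show "integrable M (\<lambda>\<omega>. (\<Sum>i\<in>S. a i * f i \<omega>) * (\<Sum>j\<in>T. b j * g j \<omega>))"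
    unfolding eq using assms by (intro Bochner_Integration.integrable_sum integrable_mult_right)
  have "(\<integral>\<omega>. (\<Sum>i\<in>S. \<Sum>j\<in>T. a i * b j * (f i \<omega> * g j \<omega>)) \<partial>M) =
      (\<Sum>i\<in>S. \<integral>\<omega>. (\<Sum>j\<in>T. a i * b j * (f i \<omega> * g j \<omega>)) \<partial>M)"
    using assms
    by (intro Bochner_Integration.integral_sum Bochner_Integration.integrable_sum
        integrable_mult_right)
  also have "\<dots> = (\<Sum>i\<in>S. \<Sum>j\<in>T. \<integral>\<omega>. a i * b j * (f i \<omega> * g j \<omega>) \<partial>M)"
    using assms by (intro sum.cong refl Bochner_Integration.integral_sum integrable_mult_right)
  finally show "(\<integral>\<omega>. (\<Sum>i\<in>S. a i * f i \<omega>) * (\<Sum>j\<in>T. b j * g j \<omega>) \<partial>M) =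
      (\<Sum>i\<in>S. \<Sum>j\<in>T. a i * b j * (\<integral>\<omega>. f i \<omega> * g j \<omega> \<partial>M))"
    by (simp add: eq)
qed

lemma integral_sum_mult:
  fixes f :: "'i \<Rightarrow> 'a \<Rightarrow> real" and g :: "'a \<Rightarrow> real"
  assumes "\<And>i. i \<in> S \<Longrightarrow> integrable M (\<lambda>\<omega>. f i \<omega> * g \<omega>)"
  shows integrable_sum_mult: "integrable M (\<lambda>\<omega>. (\<Sum>i\<in>S. a i * f i \<omega>) * g \<omega>)"
    and "(\<integral>\<omega>. (\<Sum>i\<in>S. a i * f i \<omega>) * g \<omega> \<partial>M) = (\<Sum>i\<in>S. a i * (\<integral>\<omega>. f i \<omega> * g \<omega> \<partial>M))"
  \<comment> \<open>A single right factor is a sum over a one-element index set with coefficient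
    1.\<close>
  using integral_sum_mult_sum[of S "{()}" M f "\<lambda>_. g" a "\<lambda>_. 1"]
    integrable_sum_mult_sum[of S "{()}" M f "\<lambda>_. g" a "\<lambda>_. 1"] assms
  by simp_all

section \<open>Aggregation of predictors with a common unknown mean\<close>

text \<open>Only first and second moments matter from here on. All sub-models share the mean
  \<open>hx \<bullet> \<beta>\<close> with the target, and the noises \<xi> and \<eta> do not depend
  on \<beta>; \<open>K\<close> and \<open>kM\<close> are introduced as moments of these noises, to
  be matched later with the Kriging formulas.\<close>

locale aggregation = prob_space M for M :: "'a measure" +
  fixes m p :: nat and hx :: "real vec" and V :: "real vec \<Rightarrow> 'a \<Rightarrow> real vec"
    and Z :: "real vec \<Rightarrow> 'a \<Rightarrow> real" and \<xi> :: "nat \<Rightarrow> 'a \<Rightarrow> real" and \<eta> :: "'a \<Rightarrow> real"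
    and K :: "real mat" and kM :: "real vec"
  assumes p: "p \<ge> 1" and hx: "hx \<in> carrier_vec m"
    and V: "\<beta> \<in> carrier_vec m \<Longrightarrow> V \<beta> \<omega> = vec p (\<lambda>i. hx \<bullet> \<beta> + \<xi> i \<omega>)"
    and Z: "\<beta> \<in> carrier_vec m \<Longrightarrow> Z \<beta> \<omega> = hx \<bullet> \<beta> + \<eta> \<omega>"
    and integrable_\<xi>: "i < p \<Longrightarrow> integrable M (\<xi> i)" and integrable_\<eta>: "integrable M \<eta>"
    and mean_\<xi>: "i < p \<Longrightarrow> expectation (\<xi> i) = 0" and mean_\<eta>: "expectation \<eta> = 0"
    and integrable_\<xi>_\<xi>: "i < p \<Longrightarrow> j < p \<Longrightarrow> integrable M (\<lambda>\<omega>. \<xi> i \<omega> * \<xi> j \<omega>)"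
    and integrable_\<xi>_\<eta>: "i < p \<Longrightarrow> integrable M (\<lambda>\<omega>. \<xi> i \<omega> * \<eta> \<omega>)"
    and integrable_\<eta>_\<eta>: "integrable M (\<lambda>\<omega>. \<eta> \<omega> * \<eta> \<omega>)"
    and K_eq: "K = mat p p (\<lambda>(i, j). expectation (\<lambda>\<omega>. \<xi> i \<omega> * \<xi> j \<omega>))"
    and kM_eq: "kM = vec p (\<lambda>i. expectation (\<lambda>\<omega>. \<xi> i \<omega> * \<eta> \<omega>))"
    and invertible_K: "invertible_mat K"
begin

lemma K_carrier: "K \<in> carrier_mat p p" and kM_carrier: "kM \<in> carrier_vec p"
  by (simp_all add: K_eq kM_eq)

lemma K_symmetric: "transpose_mat K = K"
  unfolding K_eq by (intro eq_matI) (simp_all add: mult.commute)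

definition noise :: "real vec \<Rightarrow> 'a \<Rightarrow> real" where
  "noise u \<omega> = (\<Sum>i<p. u $ i * \<xi> i \<omega>)"

lemma scalar_prod_V:
  assumes "u \<in> carrier_vec p" "\<beta> \<in> carrier_vec m"
  shows "u \<bullet> V \<beta> \<omega> = (u \<bullet> ones p) * (hx \<bullet> \<beta>) + noise u \<omega>"
  using assms
  by (simp add: V[OF assms(2)] scalar_prod_def[of u] ones_def noise_def lessThan_atLeast0
      distrib_left sum.distrib sum_distrib_right)

lemma noise_moments:
  assumes u: "u \<in> carrier_vec p"
  shows integrable_noise: "integrable M (noise u)"
    and expectation_noise: "expectation (noise u) = 0"
    and integrable_noise_square: "integrable M (\<lambda>\<omega>. noise u \<omega> * noise u \<omega>)"
    and expectation_noise_square: "expectation (\<lambda>\<omega>. noise u \<omega> * noise u \<omega>) = u \<bullet> (K *\<^sub>v u)"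
    and integrable_noise_\<eta>: "integrable M (\<lambda>\<omega>. noise u \<omega> * \<eta> \<omega>)"
    and expectation_noise_\<eta>: "expectation (\<lambda>\<omega>. noise u \<omega> * \<eta> \<omega>) = u \<bullet> kM"
proof -
  show "integrable M (noise u)"
    unfolding noise_def using integrable_\<xi>
    by (intro Bochner_Integration.integrable_sum integrable_mult_right) auto
  show "expectation (noise u) = 0"
    unfolding noise_def using integrable_\<xi> mean_\<xi>
    by (subst Bochner_Integration.integral_sum) auto
  show "integrable M (\<lambda>\<omega>. noise u \<omega> * noise u \<omega>)"
    unfolding noise_def using integrable_\<xi>_\<xi> by (intro integrable_sum_mult_sum) auto
  have "expectation (\<lambda>\<omega>. noise u \<omega> * noise u \<omega>) =
      (\<Sum>i<p. \<Sum>j<p. u $ i * u $ j * expectation (\<lambda>\<omega>. \<xi> i \<omega> * \<xi> j \<omega>))"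
    unfolding noise_def using integrable_\<xi>_\<xi> by (intro integral_sum_mult_sum) auto
  also have "\<dots> = (\<Sum>i<p. u $ i * (\<Sum>j<p. K $$ (i, j) * u $ j))"
    by (simp add: K_eq sum_distrib_left mult_ac)
  also have "\<dots> = u \<bullet> (K *\<^sub>v u)"
    using u K_carrier by (simp add: scalar_prod_def lessThan_atLeast0)
  finally show "expectation (\<lambda>\<omega>. noise u \<omega> * noise u \<omega>) = u \<bullet> (K *\<^sub>v u)" .
  show "integrable M (\<lambda>\<omega>. noise u \<omega> * \<eta> \<omega>)"
    unfolding noise_def using integrable_\<xi>_\<eta> by (intro integrable_sum_mult) auto
  have "expectation (\<lambda>\<omega>. noise u \<omega> * \<eta> \<omega>) = (\<Sum>i<p. u $ i * expectation (\<lambda>\<omega>. \<xi> i \<omega> * \<eta> \<omega>))"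
    unfolding noise_def using integrable_\<xi>_\<eta> by (intro integral_sum_mult) auto
  also have "\<dots> = u \<bullet> kM"
    using u by (simp add: kM_eq scalar_prod_def lessThan_atLeast0)
  finally show "expectation (\<lambda>\<omega>. noise u \<omega> * \<eta> \<omega>) = u \<bullet> kM" .
qed

text \<open>The quadratic form is the expectation of a squared noise.\<close>

lemma K_psd: "u \<in> carrier_vec p \<Longrightarrow> 0 \<le> u \<bullet> (K *\<^sub>v u)"
  by (simp flip: expectation_noise_square)

section \<open>Unbiasedness and mean square error of weighted predictors\<close>

lemma expectation_V:
  assumes "u \<in> carrier_vec p" "\<beta> \<in> carrier_vec m"
  shows "(\<integral>\<omega>. u \<bullet> V \<beta> \<omega> \<partial>M) = (u \<bullet> ones p) * (hx \<bullet> \<beta>)"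
  using integrable_noise[OF assms(1)] expectation_noise[OF assms(1)]
  by (simp add: scalar_prod_V[OF assms] prob_space)

lemma expectation_Z:
  "\<beta> \<in> carrier_vec m \<Longrightarrow> (\<integral>\<omega>. Z \<beta> \<omega> \<partial>M) = hx \<bullet> \<beta>"
  using integrable_\<eta> mean_\<eta> by (simp add: Z prob_space)

lemma unbiased_predictor_scalar_prod:
  assumes "u \<in> carrier_vec p" "u \<bullet> ones p = 1"
  shows "unbiased_predictor M m V Z (\<lambda>v. u \<bullet> v)"
  using assms by (simp add: unbiased_predictor_def expectation_V expectation_Z)

text \<open>Unbiasedness is tested at the parameter \<beta> = \<open>hx\<close>, where the common
  mean \<open>hx \<bullet> hx\<close> is nonzero and can be cancelled.\<close>

lemma unbiased_predictor_weights_sum: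
  assumes u: "u \<in> carrier_vec p" "unbiased_predictor M m V Z (\<lambda>v. u \<bullet> v)" and "hx \<noteq> 0\<^sub>v m"
  shows "u \<bullet> ones p = 1"
proof -
  have "hx \<bullet> hx \<noteq> 0"
  proof
    assume "hx \<bullet> hx = 0"
    then have "\<forall>i\<in>{0..<dim_vec hx}. hx $ i * hx $ i = 0"
      unfolding scalar_prod_def by (subst (asm) sum_nonneg_eq_0_iff) simp_all
    then have "hx = 0\<^sub>v m"
      using hx by (intro eq_vecI) auto
    with \<open>hx \<noteq> 0\<^sub>v m\<close> show False by simp
  qed
  moreover have "(u \<bullet> ones p) * (hx \<bullet> hx) = hx \<bullet> hx"
    using bspec[OF u(2)[unfolded unbiased_predictor_def] hx]
    by (simp only: expectation_V[OF u(1) hx] expectation_Z[OF hx])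
  ultimately show ?thesis by simp
qed

text \<open>With weights summing to one the unknown mean cancels between predictor and target, so
  only the noises remain in the square.\<close>

lemma mean_square_error_scalar_prod:
  assumes u: "u \<in> carrier_vec p" "u \<bullet> ones p = 1" and \<beta>: "\<beta> \<in> carrier_vec m"
  shows "mean_square_error M V Z (\<lambda>v. u \<bullet> v) \<beta> =
    expectation (\<lambda>\<omega>. \<eta> \<omega> * \<eta> \<omega>) + u \<bullet> (K *\<^sub>v u) - 2 * (u \<bullet> kM)"
proof -
  have "(u \<bullet> V \<beta> \<omega> - Z \<beta> \<omega>)\<^sup>2 = \<eta> \<omega> * \<eta> \<omega> + noise u \<omega> * noise u \<omega> - 2 * (noise u \<omega> * \<eta> \<omega>)" for \<omega>
    by (simp add: scalar_prod_V[OF u(1) \<beta>] Z[OF \<beta>] u(2) power2_eq_square algebra_simps)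
  then show ?thesis
    using noise_moments[OF u(1)] integrable_\<eta>_\<eta> by (simp add: mean_square_error_def)
qed

section \<open>Optimality of the aggregated predictor\<close>

lemma inv_K_ones_nonzero: "ones p \<bullet> (inv_mat K *\<^sub>v ones p) \<noteq> 0"
  by (rule psd_inv_mat_ones_nonzero[OF K_carrier invertible_K K_symmetric K_psd p])

lemma V_carrier: "\<beta> \<in> carrier_vec m \<Longrightarrow> V \<beta> \<omega> \<in> carrier_vec p"
  by (simp add: V)

lemma agg_predictor_V:
  "\<beta> \<in> carrier_vec m \<Longrightarrow> agg_predictor K kM (V \<beta> \<omega>) = agg_weights K kM \<bullet> V \<beta> \<omega>"
  by (rule agg_predictor_eq_scalar_prod[OF K_carrier invertible_K kM_carrier V_carrier])

lemmas agg_weights_facts =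
  agg_weights[OF K_carrier invertible_K K_symmetric kM_carrier inv_K_ones_nonzero]

lemma linear_form_agg_predictor: "linear_form p (agg_predictor K kM)"
  by (rule linear_form_scalar_prodI[OF agg_weights_facts(1)
        agg_predictor_eq_scalar_prod[OF K_carrier invertible_K kM_carrier]])

lemma unbiased_agg_predictor: "unbiased_predictor M m V Z (agg_predictor K kM)"
  using unbiased_predictor_scalar_prod[OF agg_weights_facts(1,2)]
  by (simp add: unbiased_predictor_def agg_predictor_V)

lemma mean_square_error_agg_predictor:
  assumes "\<beta> \<in> carrier_vec m"
  shows "mean_square_error M V Z (agg_predictor K kM) \<beta> =
    expectation (\<lambda>\<omega>. \<eta> \<omega> * \<eta> \<omega>) + agg_weights K kM \<bullet> (K *\<^sub>v agg_weights K kM)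
      - 2 * (agg_weights K kM \<bullet> kM)"
  using mean_square_error_scalar_prod[OF agg_weights_facts(1,2) assms]
  by (simp add: mean_square_error_def agg_predictor_V[OF assms])

lemma agg_predictor_optimal:
  assumes L: "linear_form p L" "unbiased_predictor M m V Z L"
    and \<beta>: "\<beta> \<in> carrier_vec m" and "hx \<noteq> 0\<^sub>v m"
  shows "mean_square_error M V Z (agg_predictor K kM) \<beta> \<le> mean_square_error M V Z L \<beta>"
proof -
  obtain u where u: "u \<in> carrier_vec p" and Lu: "\<And>v. v \<in> carrier_vec p \<Longrightarrow> L v = u \<bullet> v"
    using linear_form_eq_scalar_prod[OF L(1)] by blast
  \<comment> \<open>\<open>L\<close> agrees with its weight vector only on vectors of dimension
    \<open>p\<close>, but \<open>V\<close> takes values there, so unbiasedness carries over; the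
    error is transferred in the same way below.\<close>
  have "unbiased_predictor M m V Z (\<lambda>v. u \<bullet> v)"
    using L(2) by (simp add: unbiased_predictor_def Lu V_carrier)
  then have u1: "u \<bullet> ones p = 1"
    by (rule unbiased_predictor_weights_sum[OF u _ \<open>hx \<noteq> 0\<^sub>v m\<close>])
  have "mean_square_error M V Z L \<beta> = mean_square_error M V Z (\<lambda>v. u \<bullet> v) \<beta>"
    by (simp add: mean_square_error_def Lu V_carrier[OF \<beta>])
  moreover obtain \<mu> where \<mu>: "K *\<^sub>v agg_weights K kM = kM + \<mu> \<cdot>\<^sub>v ones p"
    using agg_weights_facts(3) by blast
  moreover have "u \<bullet> ones p = agg_weights K kM \<bullet> ones p"
    using agg_weights_facts(2) u1 by simp
  ultimately show ?thesis
    using normal_equation_optimal[OF K_carrier K_symmetric K_psd agg_weights_facts(1) u kM_carrier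
        ones_carrier \<mu>]
    unfolding mean_square_error_agg_predictor[OF \<beta>] mean_square_error_scalar_prod[OF u u1 \<beta>]
    by linarith
qed

end

section \<open>Gaussian processes with trend\<close>

text \<open>Row \<open>a\<close> of the block comes from the row of \<open>X\<close> with index
  \<open>pick J a\<close>, and all columns are kept. Hence every point of a block is an observation
  point in \<open>D\<close>.\<close>

lemma row_submatrix_UNIV:
  assumes X: "X \<in> carrier_mat n d" and a: "a < dim_row (submatrix X J UNIV)"
  obtains l where "l < n" "row (submatrix X J UNIV) a = row X l"
proof
  have a': "a < card {i. i < dim_row X \<and> i \<in> J}"
    using a by (simp add: dim_submatrix)
  show "pick J a < n"
    using pick_le[of a n J] a' X by simp
  show "row (submatrix X J UNIV) a = row X (pick J a)"
  proof (rule eq_vecI)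
    fix j assume "j < dim_vec (row X (pick J a))"
    then show "row (submatrix X J UNIV) a $ j = row X (pick J a) $ j"
      using a a' X \<open>pick J a < n\<close> by (simp add: dim_submatrix submatrix_index pick_UNIV)
  qed (simp add: dim_submatrix)
qed

lemma centered_gaussian_process_moments:
  assumes M: "prob_space M" and gauss: "gaussian_process M D Y" and cent: "centered_process M D Y"
    and cov: "has_covariance_function M D Y k" and s: "s \<in> D" and t: "t \<in> D"
  shows gaussian_process_integrable: "integrable M (Y s)"
    and gaussian_process_integrable_mult: "integrable M (\<lambda>\<omega>. Y s \<omega> * Y t \<omega>)"
    and centered_process_integral: "(\<integral>\<omega>. Y s \<omega> \<partial>M) = 0"
    and centered_process_covariance: "(\<integral>\<omega>. Y s \<omega> * Y t \<omega> \<partial>M) = k s t"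
proof -
  interpret prob_space M by fact
  have rv: "gaussian_rv M (Y u)" if "u \<in> D" for u
    \<comment> \<open>A single variable is the linear combination over a singleton with coefficient
      1.\<close>
    using gauss[unfolded gaussian_process_def, rule_format, of "{u}" "\<lambda>_. 1"] that by simp
  have meas: "Y u \<in> borel_measurable M" if "u \<in> D" for u
    using rv[OF that] by (simp add: gaussian_rv_def)
  note sq = gaussian_rv_square_integrable[OF M rv]
  show "integrable M (\<lambda>\<omega>. Y s \<omega> * Y t \<omega>)"
    by (rule integrable_mult_square_integrable[OF meas[OF s] meas[OF t] sq[OF s] sq[OF t]])
  show "integrable M (Y s)"
    by (rule square_integrable_imp_integrable[OF meas[OF s] sq[OF s]])
  show "(\<integral>\<omega>. Y s \<omega> \<partial>M) = 0"
    using cent s by (simp add: centered_process_def)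
  show "(\<integral>\<omega>. Y s \<omega> * Y t \<omega> \<partial>M) = k s t"
    using cent cov s t by (simp add: centered_process_def has_covariance_function_def)
qed

lemma eval_rows_trend_process:
  assumes \<beta>: "\<beta> \<in> carrier_vec m"
  shows "eval_rows (\<lambda>a. trend_process m h Y \<beta> a \<omega>) A =
    trend_mat m h A *\<^sub>v \<beta> + eval_rows (\<lambda>a. Y a \<omega>) A"
  using \<beta>
  by (intro eq_vecI)
    (auto simp: eval_rows_def trend_mat_def trend_process_def scalar_prod_def lessThan_atLeast0
      mult.commute intro!: sum.cong)

text \<open>When h(x) = 0, \<open>Z\<close> and all linear predictors have mean zero, so
  unbiasedness puts no constraint on the weights; the optimality clause is therefore stated for h(x)
  \<noteq> 0.\<close>

theorem proposition10:
  fixes M :: "'a measure"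
    and Y :: "real vec \<Rightarrow> 'a \<Rightarrow> real"
    and k :: "real vec \<Rightarrow> real vec \<Rightarrow> real"
    and D :: "real vec set"
    and h :: "nat \<Rightarrow> real vec \<Rightarrow> real"
    and d m n p :: nat
    and X :: "real mat"
    and I :: "nat \<Rightarrow> nat set"
    and x :: "real vec"
  assumes "prob_space M"
    and "D \<subseteq> carrier_vec d"
    and "gaussian_process M D Y"
    and "centered_process M D Y"
    and "has_covariance_function M D Y k"
    and "X \<in> carrier_mat n d"
    and "\<forall>l<n. row X l \<in> D"
    and "p \<ge> 1"
    and "\<forall>i<p. I i \<noteq> {}"
    and "disjoint_family_on I {..<p}"
    and "(\<Union>i<p. I i) = {..<n}"
    and "x \<in> D"
    and "\<forall>i<p. invertible_mat (cov_mat k (submatrix X (I i) UNIV) (submatrix X (I i) UNIV))"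
    and "\<forall>i<p. invertible_mat (gls_normal_mat k m h (submatrix X (I i) UNIV))"
    and "invertible_mat (uk_cov_mat k m h p (\<lambda>i. submatrix X (I i) UNIV) x)"
  shows
    "let Xs = (\<lambda>i. submatrix X (I i) UNIV);
         K = uk_cov_mat k m h p Xs x;
         kM = uk_cov_vec k m h p Xs x;
         Z = (\<lambda>\<beta>. trend_process m h Y \<beta> x);
         M_UK = (\<lambda>\<beta> \<omega>. uk_submodels k m h p Xs x (\<lambda>a. trend_process m h Y \<beta> a \<omega>));
         agg = agg_predictor K kM;
         \<alpha> = agg_weights K kM
     in linear_form p agg
        \<and> unbiased_predictor M m M_UK Z agg
        \<and> (trend_vec m h x \<noteq> 0\<^sub>v m \<longrightarrow>
             (\<forall>L. linear_form p L \<and> unbiased_predictor M m M_UK Z L \<longrightarrow>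
                (\<forall>\<beta>\<in>carrier_vec m. mean_square_error M M_UK Z agg \<beta> \<le> mean_square_error M M_UK Z L \<beta>)))
        \<and> (\<forall>\<beta>\<in>carrier_vec m. \<forall>\<omega>\<in>space M. agg (M_UK \<beta> \<omega>) = \<alpha> \<bullet> M_UK \<beta> \<omega>)
        \<and> (\<forall>\<beta>\<in>carrier_vec m. mean_square_error M M_UK Z agg \<beta>
              = k x x + (\<alpha> \<^sub>v* K) \<bullet> \<alpha> - 2 * (\<alpha> \<bullet> kM))"
proof -
  define Xs where "Xs = (\<lambda>i. submatrix X (I i) UNIV)"
  define w where "w = (\<lambda>i. uk_weights k m h (Xs i) x)"
  define \<xi> where "\<xi> = (\<lambda>i \<omega>. \<Sum>a<dim_row (Xs i). w i $ a * Y (row (Xs i) a) \<omega>)"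
  define K where "K = uk_cov_mat k m h p Xs x"
  define kM where "kM = uk_cov_vec k m h p Xs x"
  define Z where "Z = (\<lambda>\<beta>. trend_process m h Y \<beta> x)"
  define V where "V = (\<lambda>\<beta> \<omega>. uk_submodels k m h p Xs x (\<lambda>a. trend_process m h Y \<beta> a \<omega>))"
  interpret prob_space M by fact
  have rows: "row (Xs i) a \<in> D" if "a < dim_row (Xs i)" for i a
    using that row_submatrix_UNIV[OF assms(6), of a "I i"] assms(7) unfolding Xs_def by metis
  note moments = centered_gaussian_process_moments[OF assms(1,3,4,5)]
  have Xs: "Xs i \<in> carrier_mat (dim_row (Xs i)) (dim_col (Xs i))" for i
    by simp
  have inv: "invertible_mat (cov_mat k (Xs i) (Xs i))" "invertible_mat (gls_normal_mat k m h (Xs i))"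
    if "i < p" for i
    using assms(13,14) that by (simp_all add: Xs_def)
  have w: "w i \<in> carrier_vec (dim_row (Xs i))" if "i < p" for i
    unfolding w_def by (rule uk_weights_carrier[OF Xs inv[OF that]])
  have integrable_rows: "integrable M (\<lambda>\<omega>. Y (row (Xs i) a) \<omega> * Y (row (Xs j) b) \<omega>)"
    if "a < dim_row (Xs i)" "b < dim_row (Xs j)" for i j a b
    using moments(2)[OF rows rows] that .
  \<comment> \<open>Bilinearity of the expectation identifies the algebraic entry with the
    covariance of two sub-model noises.\<close>
  have K_entry: "(w i \<^sub>v* cov_mat k (Xs i) (Xs j)) \<bullet> w j = expectation (\<lambda>\<omega>. \<xi> i \<omega> * \<xi> j \<omega>)"
    if "i < p" "j < p" for i j
  proof -
    have C: "cov_mat k (Xs i) (Xs j) \<in> carrier_mat (dim_row (Xs i)) (dim_row (Xs j))"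
      by (simp add: cov_mat_def)
    have "expectation (\<lambda>\<omega>. \<xi> i \<omega> * \<xi> j \<omega>) = (\<Sum>a<dim_row (Xs i). \<Sum>b<dim_row (Xs j).
        w i $ a * w j $ b * expectation (\<lambda>\<omega>. Y (row (Xs i) a) \<omega> * Y (row (Xs j) b) \<omega>))"
      unfolding \<xi>_def using integrable_rows by (intro integral_sum_mult_sum) auto
    also have "\<dots> = (\<Sum>a<dim_row (Xs i). w i $ a *
        (\<Sum>b<dim_row (Xs j). k (row (Xs i) a) (row (Xs j) b) * w j $ b))"
      using moments(4)[OF rows rows] by (simp add: sum_distrib_left mult_ac)
    also have "\<dots> = w i \<bullet> (cov_mat k (Xs i) (Xs j) *\<^sub>v w j)"
      using w[OF that(2)] by (simp add: scalar_prod_def cov_mat_def lessThan_atLeast0)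
    also have "\<dots> = (w i \<^sub>v* cov_mat k (Xs i) (Xs j)) \<bullet> w j"
      by (rule vec_mult_mat_scalar_prod[OF C w[OF that(1)] w[OF that(2)], symmetric])
    finally show ?thesis ..
  qed
  have kM_entry: "w i \<bullet> eval_rows (\<lambda>a. k a x) (Xs i) = expectation (\<lambda>\<omega>. \<xi> i \<omega> * Y x \<omega>)"
    if "i < p" for i
  proof -
    have "expectation (\<lambda>\<omega>. \<xi> i \<omega> * Y x \<omega>) = (\<Sum>a<dim_row (Xs i).
        w i $ a * expectation (\<lambda>\<omega>. Y (row (Xs i) a) \<omega> * Y x \<omega>))"
      unfolding \<xi>_def using moments(2)[OF rows assms(12)] by (intro integral_sum_mult) auto
    also have "\<dots> = w i \<bullet> eval_rows (\<lambda>a. k a x) (Xs i)"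
      using moments(4)[OF rows assms(12)]
      by (simp add: scalar_prod_def eval_rows_def lessThan_atLeast0)
    finally show ?thesis ..
  qed
  \<comment> \<open>The weights reproduce the trend exactly, so applying them to trend plus
    \<open>Y\<close> leaves the mean at \<open>x\<close> plus the noise \<xi>.\<close>
  have submodel: "uk_predictor k m h (Xs i) (eval_rows (\<lambda>a. trend_process m h Y \<beta> a \<omega>) (Xs i)) x =
      trend_vec m h x \<bullet> \<beta> + \<xi> i \<omega>" if "i < p" and \<beta>: "\<beta> \<in> carrier_vec m" for i \<beta> \<omega>
  proof -
    have y: "eval_rows (\<lambda>a. Y a \<omega>) (Xs i) \<in> carrier_vec (dim_row (Xs i))"
      by (simp add: eval_rows_def)
    note H\<beta> = mult_mat_vec_carrier[OF trend_mat_carrier[OF Xs[of i] inv[OF that(1)]] \<beta>]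
    have "w i \<bullet> (trend_mat m h (Xs i) *\<^sub>v \<beta> + eval_rows (\<lambda>a. Y a \<omega>) (Xs i)) =
        trend_vec m h x \<bullet> \<beta> + w i \<bullet> eval_rows (\<lambda>a. Y a \<omega>) (Xs i)"
      using scalar_prod_add_distrib[OF w[OF that(1)] H\<beta> y]
        uk_weights_trend[OF Xs inv[OF that(1)] \<beta>, of x] by (simp add: w_def)
    also have "w i \<bullet> eval_rows (\<lambda>a. Y a \<omega>) (Xs i) = \<xi> i \<omega>"
      by (simp add: \<xi>_def scalar_prod_def eval_rows_def lessThan_atLeast0)
    finally show ?thesis
      using uk_predictor_eq_weights[OF Xs inv[OF that(1)] add_carrier_vec[OF H\<beta> y], of x]
      by (simp add: eval_rows_trend_process[OF \<beta>] w_def)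
  qed
  \<comment> \<open>The target noise \<eta> is \<open>Y x\<close>; the entries computed above show
    that the Kriging matrix and vector are the required second moments.\<close>
  interpret aggregation M m p "trend_vec m h x" V Z \<xi> "Y x" K kM
  proof
    show "p \<ge> 1" by fact
    show "trend_vec m h x \<in> carrier_vec m" by (simp add: trend_vec_def)
    show "V \<beta> \<omega> = vec p (\<lambda>i. trend_vec m h x \<bullet> \<beta> + \<xi> i \<omega>)" if "\<beta> \<in> carrier_vec m" for \<beta> \<omega>
      unfolding V_def uk_submodels_def by (intro eq_vecI) (simp_all add: submodel that)
    show "Z \<beta> \<omega> = trend_vec m h x \<bullet> \<beta> + Y x \<omega>" if "\<beta> \<in> carrier_vec m" for \<beta> \<omega>
      using that by (simp add: Z_def trend_process_def trend_vec_def scalar_prod_def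
          lessThan_atLeast0 mult.commute)
    show "integrable M (\<xi> i)" for i
      unfolding \<xi>_def using moments(1)[OF rows rows]
      by (intro Bochner_Integration.integrable_sum integrable_mult_right) auto
    show "expectation (\<xi> i) = 0" for i
      unfolding \<xi>_def using moments(1)[OF rows rows] moments(3)[OF rows rows]
      by (subst Bochner_Integration.integral_sum) auto
    show "integrable M (Y x)" "expectation (Y x) = 0" "integrable M (\<lambda>\<omega>. Y x \<omega> * Y x \<omega>)"
      by (rule moments[OF assms(12,12)])+
    show "integrable M (\<lambda>\<omega>. \<xi> i \<omega> * \<xi> j \<omega>)" for i j
      unfolding \<xi>_def using integrable_rows by (intro integrable_sum_mult_sum) auto
    show "integrable M (\<lambda>\<omega>. \<xi> i \<omega> * Y x \<omega>)" for i
      unfolding \<xi>_def using moments(2)[OF rows assms(12)] by (intro integrable_sum_mult) auto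
    show "K = mat p p (\<lambda>(i, j). expectation (\<lambda>\<omega>. \<xi> i \<omega> * \<xi> j \<omega>))"
      unfolding K_def uk_cov_mat_def by (intro eq_matI) (simp_all add: K_entry[unfolded w_def])
    show "kM = vec p (\<lambda>i. expectation (\<lambda>\<omega>. \<xi> i \<omega> * Y x \<omega>))"
      unfolding kM_def uk_cov_vec_def by (intro eq_vecI) (simp_all add: kM_entry[unfolded w_def])
    show "invertible_mat K"
      using assms(15) by (simp add: K_def Xs_def)
  qed
  \<comment> \<open>The second moment of \<open>Y x\<close> is \<open>k x x\<close>, and the
    quadratic form is rewritten with \<alpha> as a row vector on the left of
    \<open>K\<close>.\<close>
  have mse: "mean_square_error M V Z (agg_predictor K kM) \<beta> =
      k x x + (agg_weights K kM \<^sub>v* K) \<bullet> agg_weights K kM - 2 * (agg_weights K kM \<bullet> kM)"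
    if "\<beta> \<in> carrier_vec m" for \<beta>
    using mean_square_error_agg_predictor[OF that] moments(4)[OF assms(12,12)]
      vec_mult_mat_scalar_prod[OF K_carrier agg_weights_facts(1) agg_weights_facts(1)] by simp
  have "linear_form p (agg_predictor K kM)
      \<and> unbiased_predictor M m V Z (agg_predictor K kM)
      \<and> (trend_vec m h x \<noteq> 0\<^sub>v m \<longrightarrow>
           (\<forall>L. linear_form p L \<and> unbiased_predictor M m V Z L \<longrightarrow>
              (\<forall>\<beta>\<in>carrier_vec m. mean_square_error M V Z (agg_predictor K kM) \<beta> \<le> mean_square_error M V Z L \<beta>)))
      \<and> (\<forall>\<beta>\<in>carrier_vec m. \<forall>\<omega>\<in>space M. agg_predictor K kM (V \<beta> \<omega>) = agg_weights K kM \<bullet> V \<beta> \<omega>)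
      \<and> (\<forall>\<beta>\<in>carrier_vec m. mean_square_error M V Z (agg_predictor K kM) \<beta>
            = k x x + (agg_weights K kM \<^sub>v* K) \<bullet> agg_weights K kM - 2 * (agg_weights K kM \<bullet> kM))"
    using linear_form_agg_predictor unbiased_agg_predictor agg_predictor_optimal agg_predictor_V mse
    by blast
  then show ?thesis
    unfolding Let_def Xs_def K_def kM_def Z_def V_def .
qed

end
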